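(* Let $n\ge1$. Let $f\in\ell^2(\mathbb{Z}^n)$ with $f\neq0$ and let $g\in\ell^2(\mathbb{Z}^n)$ be a non-zero window function. Let $\Sigma\subset\mathbb{Z}^n\times\mathbb{T}^n$ be measurable with $(\nu\otimes\mu)(\Sigma)<\infty$ and let $0\le\varepsilon_\Sigma<1$. If $V_gf$ is $\varepsilon_\Sigma$-time-frequency concentrated on $\Sigma$, then $$(\nu\otimes\mu)(\Sigma)\ge1-\varepsilon_\Sigma^2.$$
   Context: For $f,g\in\ell^2(\mathbb{Z}^n)$ the short-time Fourier transform (STFT) of $f$ with window $g$ is the function on $\mathbb{Z}^n\times\mathbb{T}^n$ (where $\mathbb{T}^n=\mathbb{R}^n/\mathbb{Z}^n$) given by $V_gf(m,w)=\sum_{k\in\mathbb{Z}^n}f(k)\,\overline{g(k-m)}\,e^{-2\pi i w\cdot k}$. The measure $\nu\otimes\mu$ on $\mathbb{Z}^n\times\mathbb{T}^n$ is the product of the counting measure $\nu$ on $\mathbb{Z}^n$ and the Lebesgue measure $\mu$ on $\mathbb{T}^n$ (total mass $1$); $L^2(\mathbb{Z}^n\times\mathbb{T}^n)$ is taken with respect to $\nu\otimes\mu$. For a measurable $\Sigma\subset\mathbb{Z}^n\times\mathbb{T}^n$ and $0\le\varepsilon_\Sigma<1$, $V_gf$ is called $\varepsilon_\Sigma$-time-frequency concentrated on $\Sigma$ if $\|\chi_{\Sigma^c}V_gf\|_{L^2(\mathbb{Z}^n\times\mathbb{T}^n)}\le\varepsilon_\Sigma\|V_gf\|_{L^2(\mathbb{Z}^n\times\mathbb{T}^n)}$,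 where $\chi_{\Sigma^c}$ is the characteristic function of the complement of $\Sigma$. *)

theory Defs
  imports "HOL-Analysis.Analysis"
begin

definition square_summable :: "('a \<Rightarrow> complex) \<Rightarrow> bool" where
  "square_summable f \<longleftrightarrow> (\<lambda>k. (cmod (f k))\<^sup>2) summable_on UNIV"

text \<open>The torus \<open>\<real>\<^sup>n / \<int>\<^sup>n\<close> is represented by its fundamental domain \<open>[0,1)\<^sup>n\<close>, with \<open>n = CARD('n)\<close>.\<close>

definition fund_domain :: "(real ^ 'n) set" where
  "fund_domain = {w. \<forall>i. 0 \<le> w $ i \<and> w $ i < 1}"

definition torus_measure :: "(real ^ 'n) measure" where
  "torus_measure = lebesgue_on fund_domain"

definition tf_measure :: "((int ^ 'n) \<times> (real ^ 'n)) measure" where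
  "tf_measure = count_space UNIV \<Otimes>\<^sub>M torus_measure"

definition pairing :: "real ^ 'n \<Rightarrow> int ^ 'n \<Rightarrow> real" where
  "pairing w k = (\<Sum>i\<in>UNIV. w $ i * of_int (k $ i))"

text \<open>For square-summable \<open>f\<close> and \<open>g\<close> the series converges absolutely (Cauchy--Schwarz), so the
  unordered sum \<open>infsum\<close> is the intended one.\<close>

definition stft :: "(int ^ 'n \<Rightarrow> complex) \<Rightarrow> (int ^ 'n \<Rightarrow> complex) \<Rightarrow> (int ^ 'n) \<times> (real ^ 'n) \<Rightarrow> complex" where
  "stft g f = (\<lambda>(m, w). \<Sum>\<^sub>\<infinity>k. f k * cnj (g (k - m)) * exp (- 2 * of_real pi * \<i> * of_real (pairing w k)))"

text \<open>The norm takes values in \<^typ>\<open>ennreal\<close>, so that a function outside \<open>L\<^sup>2\<close> has norm \<open>\<infinity>\<close>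
  rather than a default value.\<close>

definition L2_norm_on :: "'a measure \<Rightarrow> ('a \<Rightarrow> complex) \<Rightarrow> ennreal" where
  "L2_norm_on M F =
    (let I = (\<integral>\<^sup>+ z. ennreal ((cmod (F z))\<^sup>2) \<partial>M)
     in if I = \<infinity> then \<infinity> else ennreal (sqrt (enn2real I)))"

definition tf_concentrated ::
  "real \<Rightarrow> ((int ^ 'n) \<times> (real ^ 'n)) set \<Rightarrow> ((int ^ 'n) \<times> (real ^ 'n) \<Rightarrow> complex) \<Rightarrow> bool" where
  "tf_concentrated \<epsilon> \<Sigma> F \<longleftrightarrow>
    L2_norm_on tf_measure (\<lambda>z. indicator (space tf_measure - \<Sigma>) z * F z)
      \<le> ennreal \<epsilon> * L2_norm_on tf_measure F"

text \<open>Sanity checks for the representation of the torus: \<open>stft g f\<close> is \<open>\<int>\<^sup>n\<close>-periodic in the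
  frequency variable, and the torus has total mass 1.\<close>

lemma stft_periodic:
  fixes f g :: "int ^ 'n \<Rightarrow> complex"
  shows "stft g f (m, w + (\<chi> i. of_int (j $ i))) = stft g f (m, w)"
proof -
  have "exp (- 2 * of_real pi * \<i> * of_real (pairing (w + (\<chi> i. of_int (j $ i))) k))
      = exp (- 2 * of_real pi * \<i> * of_real (pairing w k))" for k :: "int ^ 'n"
  proof -
    define l where "l = (\<Sum>i\<in>UNIV. j $ i * k $ i)"
    have "pairing (w + (\<chi> i. of_int (j $ i))) k = pairing w k + of_int l"
      by (simp add: pairing_def l_def sum.distrib algebra_simps)
    then show ?thesis
      by (auto simp: exp_eq algebra_simps intro!: exI[of _ "- l"])
  qed
  then show ?thesis by (simp add: stft_def)
qed

lemma emeasure_torus: "emeasure (torus_measure :: (real ^ 'n) measure) (space torus_measure) = 1"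
proof -
  let ?D = "fund_domain :: (real ^ 'n) set"
  have box: "box 0 1 \<subseteq> ?D" and cbox: "?D \<subseteq> cbox 0 (1 :: real ^ 'n)"
    by (auto simp: fund_domain_def mem_box_cart less_imp_le)
  have D: "?D = (\<Inter>i. {w. 0 \<le> w $ i} \<inter> {w. w $ i < 1})"
    by (auto simp: fund_domain_def)
  have meas: "?D \<in> sets lborel"
    unfolding D by measurable
  have vol: "emeasure lborel (box 0 (1 :: real ^ 'n)) = 1"
    "emeasure lborel (cbox 0 (1 :: real ^ 'n)) = 1"
    by (auto simp: emeasure_lborel_box_eq emeasure_lborel_cbox_eq Basis_vec_def inner_axis
          intro!: prod.neutral)
  have "emeasure lborel ?D = 1"
    using emeasure_mono[OF box, of lborel] emeasure_mono[OF cbox, of lborel] meas vol by auto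
  then show ?thesis
    using meas by (simp add: torus_measure_def emeasure_restrict_space space_restrict_space)
qed

end

theory Submission
  imports Defs
begin

text \<open>For fixed \<open>m\<close> the function \<open>V\<^sub>g f(m, \<cdot>)\<close> is the Fourier series of the summable sequence
  \<open>k \<mapsto> f(k) cnj (g(k - m))\<close>, so Parseval's identity on the torus, summed over \<open>m\<close>, gives
  \<open>\<parallel>V\<^sub>g f\<parallel>\<^sup>2 = \<parallel>f\<parallel>\<^sup>2 \<parallel>g\<parallel>\<^sup>2\<close>, while Cauchy--Schwarz bounds \<open>\<bar>V\<^sub>g f\<bar>\<^sup>2\<close> pointwise by the same
  number. Hence the part of the energy on \<open>\<Sigma>\<close>, which is at least \<open>(1 - \<epsilon>\<^sup>2) \<parallel>f\<parallel>\<^sup>2 \<parallel>g\<parallel>\<^sup>2\<close>,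
  is at most \<open>\<parallel>f\<parallel>\<^sup>2 \<parallel>g\<parallel>\<^sup>2\<close> times the measure of \<open>\<Sigma>\<close>.\<close>

section \<open>Absolutely convergent series in a bounded orthonormal system\<close>

lemma borel_measurable_cnj [measurable]: "cnj \<in> borel_measurable borel"
  by (intro borel_measurable_continuous_onI continuous_intros)

text \<open>Fubini on the product of counting measure with \<open>N\<close>: the integrand is
  dominated by \<open>norm (h k) * B\<close>, which is integrable because \<open>h\<close> is
  absolutely summable and \<open>N\<close> is finite. The free factor \<open>c\<close> lets one
  exchange serve both for extracting coefficients and for computing a norm.\<close>

lemma integral_infinite_sum_mult:
  fixes h :: "'a::countable \<Rightarrow> complex" and e :: "'a \<Rightarrow> 'b \<Rightarrow> complex"
  assumes N: "finite_measure N"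
    and e [measurable]: "\<And>k. e k \<in> borel_measurable N" and e1: "\<And>k w. norm (e k w) \<le> 1"
    and h: "integrable (count_space UNIV) h"
    and c [measurable]: "c \<in> borel_measurable N" and cB: "\<And>w. norm (c w) \<le> B"
  shows "(LINT w|N. (LINT k|count_space UNIV. h k * e k w) * c w)
       = (LINT k|count_space UNIV. h k * (LINT w|N. e k w * c w))"
proof -
  interpret N: finite_measure N by fact
  interpret C: sigma_finite_measure "count_space (UNIV :: 'a set)"
    by (rule sigma_finite_measure_count_space)
  interpret P: pair_sigma_finite "count_space (UNIV :: 'a set)" N ..
  let ?F = "\<lambda>(k, w). h k * e k w * c w"
  have B: "0 \<le> B"
    using cB norm_ge_zero order_trans by blast
  have meas [measurable]: "?F \<in> borel_measurable (count_space UNIV \<Otimes>\<^sub>M N)"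
    by (rule measurable_pair_measure_countable1) simp_all
  have bnd: "norm (h k * e k w * c w) \<le> norm (h k) * B" for k w
    unfolding norm_mult using mult_mono[OF e1[of k w] cB[of w]] B
    by (simp add: mult.assoc mult_left_mono)
  have int2: "integrable N (\<lambda>w. h k * e k w * c w)" for k
    by (rule N.integrable_const_bound[where B = "norm (h k) * B"]) (use bnd in auto)
  have "integrable (count_space UNIV \<Otimes>\<^sub>M N) ?F"
  proof (rule P.Fubini_integrable)
    show "integrable (count_space UNIV) (\<lambda>k. LINT w|N. norm (?F (k, w)))"
    proof (rule Bochner_Integration.integrable_bound)
      show "integrable (count_space UNIV) (\<lambda>k. norm (h k) * B * measure N (space N))"
        using h by auto
      have "(LINT w|N. norm (?F (k, w))) \<le> (LINT w|N. norm (h k) * B)" for k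
        by (rule integral_mono) (use int2[of k] bnd in auto)
      then show "AE k in count_space UNIV. norm (LINT w|N. norm (?F (k, w)))
          \<le> norm (norm (h k) * B * measure N (space N))"
        using B by (simp add: mult.commute mult.left_commute abs_mult)
    qed simp
  qed (use int2 in auto)
  from P.Fubini_integral[of "\<lambda>k w. h k * e k w * c w", OF this]
  show ?thesis
    by (simp add: mult.assoc flip: integral_mult_left_zero)
qed

lemma borel_measurable_infinite_sum:
  fixes h :: "'a::countable \<Rightarrow> complex" and e :: "'a \<Rightarrow> 'b \<Rightarrow> complex"
  assumes [measurable]: "\<And>k. e k \<in> borel_measurable N"
  shows "(\<lambda>w. LINT k|count_space UNIV. h k * e k w) \<in> borel_measurable N"
proof -
  interpret sigma_finite_measure "count_space (UNIV :: 'a set)"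
    by (rule sigma_finite_measure_count_space)
  have "(\<lambda>(k, w). h k * e k w) \<in> borel_measurable (count_space UNIV \<Otimes>\<^sub>M N)"
    by (rule measurable_pair_measure_countable1) simp_all
  then show ?thesis
    \<comment> \<open>The parameter integral runs over the second component, so the pair has to be
      swapped.\<close>
    by (intro borel_measurable_lebesgue_integral) (use measurable_pair_swap in simp)
qed

text \<open>Summability of \<open>h\<close> makes the series \<open>H\<close> bounded. Exchanging
  sum and integral against \<open>cnj (e k)\<close> gives the coefficients of \<open>H\<close>;
  exchanging again against \<open>cnj (H w)\<close> gives its norm.\<close>

lemma parseval_orthonormal:
  fixes h :: "'a::countable \<Rightarrow> complex" and e :: "'a \<Rightarrow> 'b \<Rightarrow> complex"
  assumes N: "finite_measure N"
    and e [measurable]: "\<And>k. e k \<in> borel_measurable N" and e1: "\<And>k w. norm (e k w) \<le> 1"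
    and ortho: "\<And>j k. (LINT w|N. e j w * cnj (e k w)) = of_bool (j = k)"
    and h: "integrable (count_space UNIV) h"
  shows "(\<integral>\<^sup>+w. ennreal ((cmod (LINT k|count_space UNIV. h k * e k w))\<^sup>2) \<partial>N)
       = (\<integral>\<^sup>+k. ennreal ((cmod (h k))\<^sup>2) \<partial>count_space UNIV)"
proof -
  interpret N: finite_measure N by fact
  define H where "H w = (LINT k|count_space UNIV. h k * e k w)" for w
  define B where "B = (LINT k|count_space UNIV. norm (h k))"
  have H_meas [measurable]: "H \<in> borel_measurable N"
    unfolding H_def by (rule borel_measurable_infinite_sum) (rule e)
  have he: "norm (h k * e k w) \<le> norm (h k)" for k w
    using mult_left_mono[OF e1[of k w] norm_ge_zero[of "h k"]] by (simp add: norm_mult)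
  have HB: "norm (H w) \<le> B" for w
    unfolding H_def B_def
    by (rule order_trans[OF integral_norm_bound integral_mono])
      (use h he in \<open>auto intro: Bochner_Integration.integrable_bound[OF h]\<close>)
  have coeff: "(LINT w|N. H w * cnj (e k w)) = h k" for k
  proof -
    have "(LINT w|N. H w * cnj (e k w)) = (LINT j|count_space UNIV. h j * of_bool (j = k))"
      unfolding H_def
      by (subst integral_infinite_sum_mult[OF N e e1 h, where B = 1]) (auto simp: e1 ortho)
    also have "\<dots> = h k"
      by (subst lebesgue_integral_count_space_finite_support)
        (auto intro: finite_subset[of _ "{k}"] simp: Collect_conv_if if_distrib cong: if_cong)
    finally show ?thesis .
  qed
  \<comment> \<open>Expanding only the first factor of \<open>H w * cnj (H w)\<close> leaves exactly
    these conjugated coefficients.\<close>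
  have coeff': "(LINT w|N. e k w * cnj (H w)) = cnj (h k)" for k
  proof -
    have "(LINT w|N. e k w * cnj (H w)) = (LINT w|N. cnj (H w * cnj (e k w)))"
      by (rule Bochner_Integration.integral_cong) (simp_all add: mult.commute)
    also have "\<dots> = cnj (h k)"
      unfolding Bochner_Integration.integral_cnj coeff ..
    finally show ?thesis .
  qed
  have "(LINT w|N. H w * cnj (H w)) = (LINT k|count_space UNIV. h k * cnj (h k))"
    using integral_infinite_sum_mult[where e = e and c = "\<lambda>w. cnj (H w)" and B = B, OF N e e1 h]
    by (simp add: HB coeff' flip: H_def)
  then have "complex_of_real (LINT w|N. (cmod (H w))\<^sup>2)
      = complex_of_real (LINT k|count_space UNIV. (cmod (h k))\<^sup>2)"
    by (simp add: complex_mult_cnj flip: cmod_power2 integral_complex_of_real of_real_power of_real_add)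
  then have eq: "(LINT w|N. (cmod (H w))\<^sup>2) = (LINT k|count_space UNIV. (cmod (h k))\<^sup>2)"
    by (simp only: of_real_eq_iff)
  \<comment> \<open>Bochner integrals default to 0 outside the integrable functions, so both sides
    need integrability before \<open>eq\<close> can be read as an identity of
    \<open>nn_integral\<close>s.\<close>
  have "integrable N (\<lambda>w. (cmod (H w))\<^sup>2)"
    by (rule N.integrable_const_bound[where B = "B\<^sup>2"])
      (simp_all add: HB power_mono)
  moreover have "integrable (count_space UNIV) (\<lambda>k. (cmod (h k))\<^sup>2)"
  proof (rule Bochner_Integration.integrable_bound)
    show "integrable (count_space UNIV) (\<lambda>k. B * cmod (h k))"
      using h by auto
    \<comment> \<open>A single term is at most the whole l1 norm; hence the square of
      \<open>cmod (h k)\<close> is at most \<open>B * cmod (h k)\<close>, which is summable.\<close>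
    have "norm (h k) \<le> B" for k
    proof -
      have "(LINT j|count_space UNIV. norm (h j) * of_bool (j = k)) \<le> B"
        unfolding B_def
        by (rule integral_mono) (use h in \<open>auto intro: Bochner_Integration.integrable_bound\<close>)
      moreover have "(LINT j|count_space UNIV. norm (h j) * of_bool (j = k)) = norm (h k)"
        by (subst lebesgue_integral_count_space_finite_support)
          (auto intro: finite_subset[of _ "{k}"] simp: Collect_conv_if if_distrib cong: if_cong)
      ultimately show ?thesis by simp
    qed
    then show "AE k in count_space UNIV. norm ((cmod (h k))\<^sup>2) \<le> norm (B * cmod (h k))"
      by (auto simp: power2_eq_square abs_mult intro!: mult_right_mono order_trans[OF _ abs_ge_self])
  qed simp
  ultimately show ?thesis
    using eq by (simp add: nn_integral_eq_integral flip: H_def)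
qed

section \<open>Orthogonality of exponentials on the fundamental domain\<close>

lemma integral_unit_character:
  fixes l :: int
  shows "(LINT x|lborel. indicator {0..<1} x *\<^sub>R exp (2 * of_real pi * \<i> * of_real x * of_int l))
    = of_bool (l = 0)" (is "(LINT x|lborel. _ *\<^sub>R ?e x) = _")
proof -
  \<comment> \<open>Adding the null endpoint 1 gives the closed interval required by the fundamental
    theorem of calculus.\<close>
  have "(LINT x|lborel. indicator {0..<1} x *\<^sub>R ?e x) = (LINT x|lborel. indicator {0..1} x *\<^sub>R ?e x)"
    by (rule integral_cong_AE) (use AE_lborel_singleton[of "1 :: real"] in \<open>auto simp: indicator_def\<close>)
  also have "\<dots> = of_bool (l = 0)"
  proof (cases "l = 0")
    case False
    define a where "a = 2 * of_real pi * \<i> * of_int l"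
    have a: "a \<noteq> 0" using False by (simp add: a_def)
    have "(LINT x|lborel. indicator {0..1} x *\<^sub>R ?e x) = exp (a * of_real 1) / a - exp (a * of_real 0) / a"
    proof (rule integral_FTC_Icc)
      show "((\<lambda>x. exp (a * of_real x) / a) has_vector_derivative ?e x) (at x within {0..1})" for x :: real
        by (rule has_vector_derivative_eq_rhs, rule has_vector_derivative_real_field)
          (use a in \<open>auto intro!: derivative_eq_intros simp: a_def mult_ac\<close>)
    qed (auto intro!: continuous_intros)
    \<comment> \<open>\<open>a\<close> is an integer multiple of 2 pi i, so the antiderivative takes
      equal values at both endpoints.\<close>
    also have "exp a = 1"
      unfolding a_def by (auto simp: exp_eq_1)
    ultimately show ?thesis using False by simp
  qed (simp add: integral_indicator_finite_real)
  finally show ?thesis .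
qed

lemma fund_domain_borel: "(fund_domain :: (real ^ 'n) set) \<in> sets borel"
proof -
  have D: "(fund_domain :: (real ^ 'n) set) = (\<Inter>i. {w. 0 \<le> w $ i} \<inter> {w. w $ i < 1})"
    by (auto simp: fund_domain_def)
  show ?thesis unfolding D by measurable
qed

lemma finite_measure_torus: "finite_measure (torus_measure :: (real ^ 'n) measure)"
  by (rule finite_measureI) (simp add: emeasure_torus)

lemma measurable_torusI: "F \<in> borel_measurable borel \<Longrightarrow> F \<in> borel_measurable torus_measure"
  unfolding torus_measure_def
  by (intro measurable_restrict_space1 measurable_completion) simp

text \<open>Completion does not change integrals of Borel functions, so torus integrals move to
  \<open>lborel\<close>, where the factorisation over coordinates applies.\<close>

lemma integral_torus:
  fixes F :: "real ^ 'n \<Rightarrow> complex"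
  assumes [measurable]: "F \<in> borel_measurable borel"
  shows "(LINT w|torus_measure. F w) = (LINT w|lborel. indicator fund_domain w *\<^sub>R F w)"
proof -
  note fund_domain_borel [measurable]
  show ?thesis
    unfolding torus_measure_def
    by (subst integral_restrict_space) (auto intro!: integral_completion)
qed

text \<open>\<open>lborel\<close> is the image of a product of one-dimensional Lebesgue measures
  under the coordinate map, and integrals of products factorise over a product measure.\<close>

lemma integral_lborel_prod:
  fixes F :: "'a::euclidean_space \<Rightarrow> real \<Rightarrow> complex"
  assumes F: "\<And>b. b \<in> Basis \<Longrightarrow> integrable lborel (F b)"
  shows "(LINT x|lborel. (\<Prod>b\<in>Basis. F b (x \<bullet> b))) = (\<Prod>b\<in>Basis. LINT t|lborel. F b t)"
proof -
  interpret product_sigma_finite "\<lambda>_::'a. lborel :: real measure" ..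
  have [measurable]: "F b \<in> borel_measurable borel" if "b \<in> Basis" for b
    using F[OF that] by auto
  have "(LINT x|lborel. (\<Prod>b\<in>Basis. F b (x \<bullet> b)))
      = (LINT y|(\<Pi>\<^sub>M b\<in>Basis. lborel). (\<Prod>b\<in>Basis. F b (y b)))"
    by (subst lborel_eq, subst integral_distr) (auto intro!: Bochner_Integration.integral_cong prod.cong)
  also have "\<dots> = (\<Prod>b\<in>Basis. LINT t|lborel. F b t)"
    by (rule product_integral_prod) (use F in auto)
  finally show ?thesis .
qed

lemma pairing_diff: "pairing w (k - j) = pairing w k - pairing w j"
  by (simp add: pairing_def sum_subtractf algebra_simps)

lemma borel_measurable_pairing [measurable]: "(\<lambda>w. pairing w k) \<in> borel_measurable borel"
  unfolding pairing_def by measurable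

lemma integral_torus_character:
  fixes k :: "int ^ 'n"
  shows "(LINT w|torus_measure. exp (2 * of_real pi * \<i> * of_real (pairing w k))) = of_bool (k = 0)"
proof -
  \<comment> \<open>The factors are indexed by basis vectors to fit
    \<open>integral_lborel_prod\<close>; \<open>THE\<close> recovers the coordinate \<open>i\<close>
    from \<open>axis i 1\<close>. Each factor carries its own share of the indicator of
    \<open>fund_domain\<close>.\<close>
  define F where "F b x = indicator {0..<1} x *\<^sub>R
    exp (2 * of_real pi * \<i> * of_real x * of_int (k $ (THE i. b = axis i 1)))" for b :: "real ^ 'n" and x :: real
  have THE_axis [simp]: "(THE j. axis i (1::real) = axis j 1) = i" for i :: 'n
    by (simp add: axis_eq_axis)
  have B: "(Basis :: (real ^ 'n) set) = range (\<lambda>i. axis i 1)"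
    by (auto simp: Basis_vec_def)
  have prod_B: "(\<Prod>b\<in>Basis. G b) = (\<Prod>i\<in>UNIV. G (axis i 1))" for G :: "real ^ 'n \<Rightarrow> complex"
    unfolding B by (subst prod.reindex) (auto simp: inj_on_def axis_eq_axis)
  have "indicator fund_domain w *\<^sub>R exp (2 * of_real pi * \<i> * of_real (pairing w k))
      = (\<Prod>b\<in>Basis. F b (w \<bullet> b))" for w :: "real ^ 'n"
  proof -
    have "indicator fund_domain w = (\<Prod>i\<in>UNIV. indicator {0..<1} (w $ i) :: real)"
      by (auto simp: fund_domain_def indicator_def intro: prod_zero)
    moreover have "exp (2 * of_real pi * \<i> * of_real (pairing w k))
        = (\<Prod>i\<in>UNIV. exp (2 * of_real pi * \<i> * of_real (w $ i) * of_int (k $ i)))"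
      by (subst exp_sum [symmetric]) (simp_all add: pairing_def sum_distrib_left mult.assoc)
    ultimately show ?thesis
      by (simp add: prod_B F_def inner_axis scaleR_conv_of_real prod.distrib)
  qed
  then have "(LINT w|torus_measure. exp (2 * of_real pi * \<i> * of_real (pairing w k)))
      = (LINT w|lborel. (\<Prod>b\<in>Basis. F b (w \<bullet> b)))"
    by (subst integral_torus) simp_all
  also have "\<dots> = (\<Prod>b\<in>Basis. LINT t|lborel. F b t)"
  proof (rule integral_lborel_prod)
    show "integrable lborel (F b)" for b
      unfolding F_def
      by (rule integrable_real_indicator[THEN Bochner_Integration.integrable_bound, of "{0..<1}"])
        (auto simp: indicator_def)
  qed
  also have "\<dots> = (\<Prod>i\<in>UNIV. of_bool (k $ i = 0))"
    unfolding prod_B F_def by (simp add: integral_unit_character)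
  also have "\<dots> = of_bool (k = 0)"
    by (auto simp: vec_eq_iff intro: prod_zero)
  finally show ?thesis .
qed

section \<open>Squared l2 norms, kept in \<open>ennreal\<close> for Tonelli, and windowed
  products\<close>

definition energy :: "('a \<Rightarrow> complex) \<Rightarrow> ennreal" where
  "energy f = (\<integral>\<^sup>+k. ennreal ((cmod (f k))\<^sup>2) \<partial>count_space UNIV)"

lemma energy_finite:
  assumes "square_summable f"
  shows "energy f < \<infinity>"
proof -
  \<comment> \<open>For real functions summability is absolute, and absolute summability is
    integrability against counting measure.\<close>
  have "Infinite_Sum.abs_summable_on (\<lambda>k. (cmod (f k))\<^sup>2) UNIV"
    using assms unfolding square_summable_def by (rule summable_on_iff_abs_summable_on_real[THEN iffD1])
  then have "integrable (count_space UNIV) (\<lambda>k. (cmod (f k))\<^sup>2)"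
    by (simp only: abs_summable_equivalent abs_summable_on_def)
  then show ?thesis
    by (simp add: energy_def integrable_iff_bounded)
qed

lemma energy_pos:
  assumes "f \<noteq> (\<lambda>_. 0)"
  shows "energy f > 0"
proof -
  have "energy f \<noteq> 0"
    using assms by (auto simp: energy_def nn_integral_0_iff_AE AE_count_space)
  then show ?thesis
    by (simp add: zero_less_iff_neq_zero)
qed

text \<open>Both \<open>k - m\<close> as a function of \<open>k\<close> and as a function of
  \<open>m\<close> are bijections. The first form enters Cauchy-Schwarz, the second the total energy
  of the STFT.\<close>

lemma energy_shift:
  fixes g :: "'a::ab_group_add \<Rightarrow> complex"
  shows "(\<integral>\<^sup>+k. ennreal ((cmod (g (k - m)))\<^sup>2) \<partial>count_space UNIV) = energy g"
    and "(\<integral>\<^sup>+m. ennreal ((cmod (g (k - m)))\<^sup>2) \<partial>count_space UNIV) = energy g"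
proof -
  have "bij (\<lambda>k. k - m)"
    by (rule bij_betw_byWitness[where f' = "\<lambda>k. k + m"]) auto
  from nn_integral_bij_count_space[OF this]
  show "(\<integral>\<^sup>+k. ennreal ((cmod (g (k - m)))\<^sup>2) \<partial>count_space UNIV) = energy g"
    unfolding energy_def .
  have "bij (\<lambda>m. k - m)"
    by (rule bij_betw_byWitness[where f' = "\<lambda>m. k - m"]) auto
  from nn_integral_bij_count_space[OF this]
  show "(\<integral>\<^sup>+m. ennreal ((cmod (g (k - m)))\<^sup>2) \<partial>count_space UNIV) = energy g"
    unfolding energy_def .
qed

text \<open>Cauchy-Schwarz for \<open>f\<close> and the translated window. The bound controls the
  STFT pointwise; its finiteness makes each section an absolutely convergent Fourier series.\<close>

lemma
  fixes f g :: "'a::{ab_group_add, countable} \<Rightarrow> complex"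
  assumes f: "square_summable f" and g: "square_summable g"
  defines "h \<equiv> \<lambda>m k. f k * cnj (g (k - m))"
  shows l1_norm_windowed_le:
      "(\<integral>\<^sup>+k. ennreal (norm (h m k)) \<partial>count_space UNIV)\<^sup>2 \<le> energy f * energy g"
    and integrable_windowed: "integrable (count_space UNIV) (h m)"
proof -
  show le: "(\<integral>\<^sup>+k. ennreal (norm (h m k)) \<partial>count_space UNIV)\<^sup>2 \<le> energy f * energy g"
    using Cauchy_Schwarz_nn_integral[of "\<lambda>k. ennreal (cmod (f k))" "count_space UNIV"
        "\<lambda>k. ennreal (cmod (g (k - m)))"]
    by (simp add: h_def norm_mult ennreal_mult ennreal_power energy_shift flip: energy_def)
  also have "\<dots> < \<infinity>"
    using energy_finite[OF f] energy_finite[OF g] by (simp add: ennreal_mult_less_top)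
  finally show "integrable (count_space UNIV) (h m)"
    by (simp add: integrable_iff_bounded power_less_top_ennreal)
qed

section \<open>Boundedness and total energy of the STFT\<close>

definition character :: "int ^ 'n \<Rightarrow> real ^ 'n \<Rightarrow> complex" where
  "character k w = exp (- 2 * of_real pi * \<i> * of_real (pairing w k))"

lemma measurable_character [measurable]: "character k \<in> borel_measurable torus_measure"
  unfolding character_def by (rule measurable_torusI) measurable

lemma norm_character: "norm (character k w) = 1"
  by (simp add: character_def)

lemma orthonormal_character:
  "(LINT w|torus_measure. character j w * cnj (character k w)) = of_bool (j = k)"
proof -
  \<comment> \<open>The minus sign in \<open>character\<close> is why the difference appears as
    \<open>k - j\<close>.\<close>
  have "character j w * cnj (character k w) = exp (2 * of_real pi * \<i> * of_real (pairing w (k - j)))" for w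
    by (simp add: character_def pairing_diff exp_cnj algebra_simps flip: exp_add)
  then show ?thesis
    by (auto simp: integral_torus_character)
qed

context
  fixes f g :: "int ^ 'n \<Rightarrow> complex"
  assumes f: "square_summable f" and g: "square_summable g"
begin

text \<open>The unordered sum agrees with the integral over counting measure because the series
  converges absolutely; this makes the Fubini-based results applicable.\<close>

lemma stft_eq_integral:
  "stft g f (m, w) = (LINT k|count_space UNIV. f k * cnj (g (k - m)) * character k w)"
proof -
  have "integrable (count_space UNIV) (\<lambda>k. f k * cnj (g (k - m)) * character k w)"
    by (rule Bochner_Integration.integrable_bound[OF integrable_windowed[OF f g]])
      (auto simp: norm_mult norm_character)
  then show ?thesis
    unfolding stft_def character_def
    by (simp add: infsetsum_infsum abs_summable_on_def flip: infsetsum_def)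
qed

text \<open>The first factor is countable and discrete, so measurability of each frequency section
  suffices.\<close>

lemma measurable_stft [measurable]: "stft g f \<in> borel_measurable tf_measure"
proof -
  have "(\<lambda>w. stft g f (m, w)) \<in> borel_measurable torus_measure" for m
    unfolding stft_eq_integral by (rule borel_measurable_infinite_sum) measurable
  then show ?thesis
    unfolding tf_measure_def by (intro measurable_pair_measure_countable1) auto
qed

lemma stft_pointwise_bound: "ennreal ((cmod (stft g f z))\<^sup>2) \<le> energy f * energy g"
proof (cases z)
  case (Pair m w)
  let ?h = "\<lambda>k. f k * cnj (g (k - m)) * character k w"
  have "integrable (count_space UNIV) ?h"
    by (rule Bochner_Integration.integrable_bound[OF integrable_windowed[OF f g]])
      (auto simp: norm_mult norm_character)
  then have "ennreal (cmod (stft g f z)) \<le> (\<integral>\<^sup>+k. ennreal (norm (?h k)) \<partial>count_space UNIV)"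
    unfolding Pair stft_eq_integral by (rule integral_norm_bound_ennreal)
  then have "(ennreal (cmod (stft g f z)))\<^sup>2
      \<le> (\<integral>\<^sup>+k. ennreal (norm (f k * cnj (g (k - m)))) \<partial>count_space UNIV)\<^sup>2"
    by (intro power_mono) (auto simp: norm_mult norm_character)
  then show ?thesis
    using l1_norm_windowed_le[OF f g, of m] by (simp add: ennreal_power)
qed

lemma stft_energy: "(\<integral>\<^sup>+z. ennreal ((cmod (stft g f z))\<^sup>2) \<partial>tf_measure) = energy f * energy g"
proof -
  interpret T: finite_measure "torus_measure :: (real ^ 'n) measure"
    by (rule finite_measure_torus)
  interpret C: sigma_finite_measure "count_space (UNIV :: (int ^ 'n) set)"
    by (rule sigma_finite_measure_count_space)
  interpret P: pair_sigma_finite "count_space (UNIV :: (int ^ 'n) set)" "count_space (UNIV :: (int ^ 'n) set)" ..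
  note measurable_stft[unfolded tf_measure_def, measurable]
  have "(\<integral>\<^sup>+z. ennreal ((cmod (stft g f z))\<^sup>2) \<partial>tf_measure)
      = (\<integral>\<^sup>+m. (\<integral>\<^sup>+w. ennreal ((cmod (stft g f (m, w)))\<^sup>2) \<partial>torus_measure) \<partial>count_space UNIV)"
    unfolding tf_measure_def by (rule T.nn_integral_fst [symmetric]) measurable
  also have "\<dots> = (\<integral>\<^sup>+m. (\<integral>\<^sup>+k. ennreal ((cmod (f k * cnj (g (k - m))))\<^sup>2) \<partial>count_space UNIV) \<partial>count_space UNIV)"
    unfolding stft_eq_integral
    by (intro nn_integral_cong parseval_orthonormal finite_measure_torus orthonormal_character
        integrable_windowed f g) (simp_all add: norm_character)
  \<comment> \<open>After Tonelli the inner sum over \<open>m\<close> meets only the window and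
    equals \<open>energy g\<close> for every \<open>k\<close>.\<close>
  also have "\<dots> = (\<integral>\<^sup>+k. (\<integral>\<^sup>+m. ennreal ((cmod (f k * cnj (g (k - m))))\<^sup>2) \<partial>count_space UNIV) \<partial>count_space UNIV)"
    by (rule P.Fubini') (auto intro!: measurable_pair_measure_countable1)
  also have "\<dots> = energy f * energy g"
    by (simp add: norm_mult power_mult_distrib ennreal_mult nn_integral_cmult nn_integral_multc
        energy_shift flip: energy_def)
  finally show ?thesis .
qed

end

section \<open>Comparing the energy on \<Sigma> with the total energy\<close>

theorem theorem3p7:
  fixes f g :: "int ^ 'n \<Rightarrow> complex"
    and \<Sigma> :: "((int ^ 'n) \<times> (real ^ 'n)) set"
    and \<epsilon> :: real
  assumes "square_summable f" and "f \<noteq> (\<lambda>_. 0)"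
    and "square_summable g" and "g \<noteq> (\<lambda>_. 0)"
    and "\<Sigma> \<in> sets tf_measure" and "emeasure tf_measure \<Sigma> < \<infinity>"
    and "0 \<le> \<epsilon>" and "\<epsilon> < 1"
    and "tf_concentrated \<epsilon> \<Sigma> (stft g f)"
  shows "emeasure tf_measure \<Sigma> \<ge> ennreal (1 - \<epsilon>\<^sup>2)"
proof -
  note [measurable] = measurable_stft[OF assms(1,3)] assms(5)
  let ?u = "\<lambda>z. ennreal ((cmod (stft g f z))\<^sup>2)"
  define J where "J = (\<integral>\<^sup>+z. ?u z * indicator (space tf_measure - \<Sigma>) z \<partial>tf_measure)"
  have "energy f * energy g < \<infinity>" "energy f * energy g > 0"
    using assms(1-4) energy_finite energy_pos by (auto simp: ennreal_mult_less_top ennreal_zero_less_mult_iff)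
  \<comment> \<open>Passing to a real \<open>i\<close> allows subtraction later, and
    \<open>i > 0\<close> allows the final cancellation.\<close>
  then obtain i where i: "energy f * energy g = ennreal i" "i > 0"
    by (cases "energy f * energy g") auto
  obtain s where s: "emeasure tf_measure \<Sigma> = ennreal s" "s \<ge> 0"
    using assms(6) by (cases "emeasure tf_measure \<Sigma>") auto
  have total: "(\<integral>\<^sup>+z. ?u z \<partial>tf_measure) = ennreal i"
    using stft_energy[OF assms(1,3)] i by simp
  have "J \<le> (\<integral>\<^sup>+z. ?u z \<partial>tf_measure)"
    unfolding J_def by (intro nn_integral_mono) (auto simp: indicator_def)
  \<comment> \<open>Finiteness of \<open>J\<close> puts \<open>L2_norm_on\<close> in its square-root
    branch.\<close>
  then obtain j where j: "J = ennreal j" "j \<ge> 0"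
    unfolding total by (cases J) (auto simp: top_unique)
  have "(\<integral>\<^sup>+z. ennreal ((cmod (indicator (space tf_measure - \<Sigma>) z * stft g f z))\<^sup>2) \<partial>tf_measure) = J"
    unfolding J_def by (intro nn_integral_cong) (auto simp: indicator_def)
  then have "ennreal (sqrt j) \<le> ennreal \<epsilon> * ennreal (sqrt i)"
    using assms(9) i j by (simp add: tf_concentrated_def L2_norm_on_def total)
  then have "sqrt j \<le> \<epsilon> * sqrt i"
    using assms(7) i by (simp flip: ennreal_mult)
  then have "(sqrt j)\<^sup>2 \<le> (\<epsilon> * sqrt i)\<^sup>2"
    using j by (intro power_mono) auto
  then have ji: "j \<le> \<epsilon>\<^sup>2 * i"
    using i j by (simp add: power_mult_distrib)
  have "ennreal i = (\<integral>\<^sup>+z. ?u z * indicator \<Sigma> z + ?u z * indicator (space tf_measure - \<Sigma>) z \<partial>tf_measure)"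
    unfolding total [symmetric] by (intro nn_integral_cong) (auto simp: indicator_def)
  also have "\<dots> = (\<integral>\<^sup>+z. ?u z * indicator \<Sigma> z \<partial>tf_measure) + J"
    unfolding J_def by (rule nn_integral_add) measurable
  \<comment> \<open>The total energy \<open>i\<close> is also the pointwise bound, so \<Sigma>
    carries at most \<open>i\<close> times its measure.\<close>
  also have "(\<integral>\<^sup>+z. ?u z * indicator \<Sigma> z \<partial>tf_measure) \<le> (\<integral>\<^sup>+z. ennreal i * indicator \<Sigma> z \<partial>tf_measure)"
    using stft_pointwise_bound[OF assms(1,3)] i by (intro nn_integral_mono mult_right_mono) auto
  also have "\<dots> = ennreal (i * s)"
    using i s by (simp add: nn_integral_cmult_indicator ennreal_mult)
  finally have "i \<le> i * s + j"
    using i j s by (simp flip: ennreal_plus)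
  with ji have "i * (1 - \<epsilon>\<^sup>2) \<le> i * s"
    by (simp add: algebra_simps)
  then show ?thesis
    using i s by (simp add: ennreal_leI)
qed

end
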